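(* Let $\mathcal{K}$ be a Krein space, $\mathcal{H}$ a Hilbert space, and let $\Gamma:\mathcal{K}^2\to\mathcal{H}^2$ be a Green's boundary relation. If $\operatorname{ran}\Gamma$ is non-degenerate and $(\operatorname{dom}\Gamma)^{[\perp]_{\mathcal{K}^2}}\subseteq\operatorname{dom}\Gamma$, then $M=N=S$, where $M:=\operatorname{dom}\Gamma\cap(\operatorname{dom}\Gamma)^{[\perp]_{\mathcal{K}^2}}$, $N:=\ker\Gamma$ and $S:=(\operatorname{dom}\Gamma)^+$.
   Context: Let $(\mathcal{K},[\cdot,\cdot])$ be a complex Krein space and $(\mathcal{H},(\cdot,\cdot))$ a Hilbert space. Elements of $\mathcal{K}^2$ are written $\hat f=(f,f')$, $\hat g=(g,g')$, and elements of $\mathcal{H}^2$ are written $\hat h=(h,h')$, $\hat k=(k,k')$. Inner products are linear in the first argument. $\mathcal{K}^2$ and $\mathcal{H}^2$ are Krein spaces with the inner products $[\hat f,\hat g]_{\mathcal{K}^2}=-i[f',g]+i[f,g']$ and $[\hat h,\hat k]_{\mathcal{H}^2}=-i(h',k)+i(h,k')$; $[\perp]_{\mathcal{K}^2}$ and $[\perp]_{\mathcal{H}^2}$ denote orthogonal companions with respect to these. A linear relation $T:X\to Y$ is a linear subspace $T\subseteq X\times Y$, with the usual $\operatorname{dom}T$, $\operatorname{ran}T$, $\ker T=\{x:(x,0)\in T\}$. For a linear subspace $T\subseteq\mathcal{K}^2$, $T^+=\{(k,h)\in\mathcal{K}^2:[f,h]=[g,k]\ \forall(f,g)\in T\}=T^{[\perp]_{\mathcal{K}^2}}$.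 The manifold $\operatorname{ran}\Gamma$ is non-degenerate if $\operatorname{ran}\Gamma\cap(\operatorname{ran}\Gamma)^{[\perp]_{\mathcal{H}^2}}=\{0\}$. A Green's boundary relation is a linear relation $\Gamma\subseteq\mathcal{K}^2\times\mathcal{H}^2$ such that $[f',g]-[f,g']=(h',k)-(h,k')$ for all $(\hat f,\hat h),(\hat g,\hat k)\in\Gamma$, equivalently $[\hat f,\hat g]_{\mathcal{K}^2}=[\hat h,\hat k]_{\mathcal{H}^2}$ for all such pairs. *)

theory Defs
  imports "HOL-Analysis.Analysis"
begin

text \<open>Complex vector spaces carrying a possibly indefinite Hermitian form, linear in the first
  argument.\<close>

locale hermitian_space = vector_space smul
  for smul :: "complex \<Rightarrow> 'a::ab_group_add \<Rightarrow> 'a" +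
  fixes ip :: "'a \<Rightarrow> 'a \<Rightarrow> complex"
  assumes ip_add_left: "ip (x + y) z = ip x z + ip y z"
    and ip_smul_left: "ip (smul c x) y = c * ip x y"
    and ip_hermitian: "ip y x = cnj (ip x y)"

text \<open>For a positive definite form, \<open>ip x x\<close> is a nonnegative real and equals its modulus; the
  modulus is used so that the distance below is nonnegative also outside \<open>V\<close>, as
  \<open>Metric_space\<close> requires.\<close>

definition ip_dist :: "('a::ab_group_add \<Rightarrow> 'a \<Rightarrow> complex) \<Rightarrow> 'a \<Rightarrow> 'a \<Rightarrow> real" where
  "ip_dist ip x y = sqrt (cmod (ip (x - y) (x - y)))"

definition hilbert_subspace ::
  "(complex \<Rightarrow> 'a::ab_group_add \<Rightarrow> 'a) \<Rightarrow> ('a \<Rightarrow> 'a \<Rightarrow> complex) \<Rightarrow> 'a set \<Rightarrow> bool" where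
  "hilbert_subspace smul ip V \<longleftrightarrow>
     module.subspace smul V \<and>
     (\<forall>x\<in>V. x \<noteq> 0 \<longrightarrow> 0 < Re (ip x x)) \<and>
     Metric_space.mcomplete V (ip_dist ip)"

locale hilbert_space = hermitian_space smul ip
  for smul :: "complex \<Rightarrow> 'a::ab_group_add \<Rightarrow> 'a" and ip :: "'a \<Rightarrow> 'a \<Rightarrow> complex" +
  assumes hilbert: "hilbert_subspace smul ip UNIV"

text \<open>A Krein space has a fundamental decomposition \<open>P [+] Q\<close>.\<close>

locale krein_space = hermitian_space smul ip
  for smul :: "complex \<Rightarrow> 'a::ab_group_add \<Rightarrow> 'a" and ip :: "'a \<Rightarrow> 'a \<Rightarrow> complex" +
  assumes fundamental_decomposition:
    "\<exists>P Q. hilbert_subspace smul ip P \<and> hilbert_subspace smul (\<lambda>x y. - ip x y) Q \<and>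
       (\<forall>x\<in>P. \<forall>y\<in>Q. ip x y = 0) \<and> P \<inter> Q = {0} \<and> (\<forall>x. \<exists>p\<in>P. \<exists>q\<in>Q. x = p + q)"

definition square_ip :: "('a \<Rightarrow> 'a \<Rightarrow> complex) \<Rightarrow> 'a \<times> 'a \<Rightarrow> 'a \<times> 'a \<Rightarrow> complex" where
  "square_ip ip = (\<lambda>(f, f') (g, g'). - \<i> * ip f' g + \<i> * ip f g')"

definition orth_companion :: "('a \<Rightarrow> 'a \<Rightarrow> complex) \<Rightarrow> 'a set \<Rightarrow> 'a set" where
  "orth_companion ip A = {x. \<forall>y\<in>A. ip x y = 0}"

definition nondegenerate :: "('a::zero \<Rightarrow> 'a \<Rightarrow> complex) \<Rightarrow> 'a set \<Rightarrow> bool" where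
  "nondegenerate ip V \<longleftrightarrow> V \<inter> orth_companion ip V = {0}"

definition linear_relation ::
  "(complex \<Rightarrow> 'a::ab_group_add \<Rightarrow> 'a) \<Rightarrow> (complex \<Rightarrow> 'b::ab_group_add \<Rightarrow> 'b) \<Rightarrow> ('a \<times> 'b) set \<Rightarrow> bool"
  where "linear_relation s1 s2 T \<longleftrightarrow> module.subspace (module_prod.scale s1 s2) T"

definition rel_ker :: "('a \<times> 'b::zero) set \<Rightarrow> 'a set" where
  "rel_ker T = {x. (x, 0) \<in> T}"

definition krein_adjoint :: "('a \<Rightarrow> 'a \<Rightarrow> complex) \<Rightarrow> ('a \<times> 'a) set \<Rightarrow> ('a \<times> 'a) set" where
  "krein_adjoint ip T = {(k, h). \<forall>(f, g)\<in>T. ip f h = ip g k}"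

definition greens_boundary_relation ::
  "(complex \<Rightarrow> 'k::ab_group_add \<Rightarrow> 'k) \<Rightarrow> ('k \<Rightarrow> 'k \<Rightarrow> complex) \<Rightarrow>
   (complex \<Rightarrow> 'h::ab_group_add \<Rightarrow> 'h) \<Rightarrow> ('h \<Rightarrow> 'h \<Rightarrow> complex) \<Rightarrow>
   (('k \<times> 'k) \<times> ('h \<times> 'h)) set \<Rightarrow> bool" where
  "greens_boundary_relation sK ipK sH ipH \<Gamma> \<longleftrightarrow>
     linear_relation (module_prod.scale sK sK) (module_prod.scale sH sH) \<Gamma> \<and>
     (\<forall>((f, f'), (h, h'))\<in>\<Gamma>. \<forall>((g, g'), (k, k'))\<in>\<Gamma>.
        ipK f' g - ipK f g' = ipH h' k - ipH h k')"

end

theory Submission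
  imports Defs
begin

text \<open>The Green identity says that \<open>\<Gamma>\<close> is isometric for the two square forms. Hence, for a pair
  \<open>(x, y) \<in> \<Gamma>\<close>, orthogonality of \<open>x\<close> to \<open>Domain \<Gamma>\<close> and orthogonality of \<open>y\<close> to \<open>Range \<Gamma>\<close> are the
  same condition. Non-degeneracy of the range turns the latter into \<open>y = 0\<close>, so the isotropic part
  of the domain is exactly the kernel (\<open>isotropic_part_eq_ker\<close>). The Krein adjoint is the orthogonal
  companion in the square form (\<open>krein_adjoint_eq_orth_companion\<close>), and the hypothesis that this
  companion lies in the domain identifies it with the isotropic part.\<close>

text \<open>Conjugation exchanges the order of the arguments in the identity defining the adjoint, and the
  factor \<open>\<i>\<close> of the square form does not affect its vanishing.\<close>

lemma (in hermitian_space) krein_adjoint_eq_orth_companion: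
  "krein_adjoint ip T = orth_companion (square_ip ip) T"
proof -
  have "ip f h = ip g k \<longleftrightarrow> square_ip ip (k, h) (f, g) = 0" for f g h k
  proof -
    have "square_ip ip (k, h) (f, g) = \<i> * (ip k g - ip h f)"
      by (simp add: square_ip_def algebra_simps)
    also have "\<dots> = 0 \<longleftrightarrow> cnj (ip f h) = cnj (ip g k)"
      by (auto simp flip: ip_hermitian)
    finally show ?thesis
      by simp
  qed
  then show ?thesis
    by (fastforce simp: krein_adjoint_def orth_companion_def)
qed

lemma (in hermitian_space) square_ip_zero_left: "square_ip ip 0 k = 0"
proof -
  have "ip 0 z = 0" for z
    using ip_add_left[of 0 0 z] by simp
  then show ?thesis
    by (cases k) (simp add: square_ip_def zero_prod_def)
qed

lemma greens_boundary_relation_isometric: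
  assumes "greens_boundary_relation sK ipK sH ipH \<Gamma>" "(x, y) \<in> \<Gamma>" "(u, v) \<in> \<Gamma>"
  shows "square_ip ipK x u = square_ip ipH y v"
proof -
  obtain f f' h h' g g' k k' where
    eqs: "x = (f, f')" "y = (h, h')" "u = (g, g')" "v = (k, k')"
    by (metis surj_pair)
  have "ipK f' g - ipK f g' = ipH h' k - ipH h k'"
    using assms unfolding greens_boundary_relation_def eqs by fast
  then have "- \<i> * (ipK f' g - ipK f g') = - \<i> * (ipH h' k - ipH h k')"
    by simp
  then show ?thesis
    by (simp add: eqs square_ip_def algebra_simps)
qed

text \<open>An isometric relation maps the isotropic part of its domain into that of its range, which here
  is trivial; conversely a vector related to \<open>0\<close> has the same inner products as \<open>0\<close>.\<close>

lemma isotropic_part_eq_ker: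
  assumes iso: "\<And>x y u v. (x, y) \<in> \<Gamma> \<Longrightarrow> (u, v) \<in> \<Gamma> \<Longrightarrow> ipX x u = ipY y v"
    and zero: "\<And>v. ipY 0 v = 0"
    and nondeg: "nondegenerate ipY (Range \<Gamma>)"
  shows "Domain \<Gamma> \<inter> orth_companion ipX (Domain \<Gamma>) = rel_ker \<Gamma>"
proof (intro equalityI subsetI)
  fix x assume x: "x \<in> Domain \<Gamma> \<inter> orth_companion ipX (Domain \<Gamma>)"
  then obtain y where y: "(x, y) \<in> \<Gamma>"
    by blast
  have "ipY y v = 0" if "v \<in> Range \<Gamma>" for v
  proof -
    from that obtain u where u: "(u, v) \<in> \<Gamma>"
      by blast
    then have "ipX x u = 0"
      using x unfolding orth_companion_def by blast
    with iso[OF y u] show ?thesis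
      by simp
  qed
  with y have "y \<in> Range \<Gamma> \<inter> orth_companion ipY (Range \<Gamma>)"
    by (auto simp: orth_companion_def)
  with nondeg have "y = 0"
    by (simp add: nondegenerate_def)
  with y show "x \<in> rel_ker \<Gamma>"
    by (simp add: rel_ker_def)
next
  fix x assume "x \<in> rel_ker \<Gamma>"
  then have x: "(x, 0) \<in> \<Gamma>"
    by (simp add: rel_ker_def)
  then show "x \<in> Domain \<Gamma> \<inter> orth_companion ipX (Domain \<Gamma>)"
    using iso[OF x] zero by (auto simp: orth_companion_def)
qed

theorem corollary5p2:
  fixes sK :: "complex \<Rightarrow> 'k::ab_group_add \<Rightarrow> 'k" and ipK :: "'k \<Rightarrow> 'k \<Rightarrow> complex"
    and sH :: "complex \<Rightarrow> 'h::ab_group_add \<Rightarrow> 'h" and ipH :: "'h \<Rightarrow> 'h \<Rightarrow> complex"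
    and \<Gamma> :: "(('k \<times> 'k) \<times> ('h \<times> 'h)) set"
  assumes "krein_space sK ipK"
    and "hilbert_space sH ipH"
    and "greens_boundary_relation sK ipK sH ipH \<Gamma>"
    and "nondegenerate (square_ip ipH) (Range \<Gamma>)"
    and "orth_companion (square_ip ipK) (Domain \<Gamma>) \<subseteq> Domain \<Gamma>"
  shows "let M = Domain \<Gamma> \<inter> orth_companion (square_ip ipK) (Domain \<Gamma>);
             N = rel_ker \<Gamma>;
             S = krein_adjoint ipK (Domain \<Gamma>)
         in M = N \<and> N = S"
proof -
  interpret K: krein_space sK ipK by fact
  interpret H: hilbert_space sH ipH by fact
  have "Domain \<Gamma> \<inter> orth_companion (square_ip ipK) (Domain \<Gamma>) = rel_ker \<Gamma>"
    using greens_boundary_relation_isometric[OF assms(3)] H.square_ip_zero_left assms(4)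
    by (rule isotropic_part_eq_ker)
  with assms(5) show ?thesis
    by (auto simp: Let_def K.krein_adjoint_eq_orth_companion)
qed

end
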